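(* Let $R_\Omega>0$, let $N_{\mathrm f}\in\mathbb{N}$, let $T_y\subset\mathbb{R}$ be a bounded interval, let $\bar{\boldsymbol x}\in\Omega\subset\mathbb{R}^2$, and let $\omega_1,\dots,\omega_{N_{\mathrm f}}\in\mathbb{R}$ be frequencies. For $\boldsymbol\xi_{\mathrm f}=[a_1\ b_1\ c_1\ d_1\ \cdots\ a_{N_{\mathrm f}}\ b_{N_{\mathrm f}}\ c_{N_{\mathrm f}}\ d_{N_{\mathrm f}}]^\top\in\mathbb{R}^{4N_{\mathrm f}}$ and $t\in T_y$ consider the Fourier path $$\boldsymbol r_{\mathrm f}(t;\boldsymbol\xi_{\mathrm f})=\bar{\boldsymbol x}+\sum_{j=1}^{N_{\mathrm f}}\begin{bmatrix}a_j\cos(\omega_jt)+b_j\sin(\omega_jt)\\ c_j\cos(\omega_jt)+d_j\sin(\omega_jt)\end{bmatrix}.$$ If $$\|\boldsymbol\xi_{\mathrm f}\|_2\le\frac{R_\Omega}{\sqrt{N_{\mathrm f}}},$$ then $\|\boldsymbol r_{\mathrm f}(t;\boldsymbol\xi_{\mathrm f})-\bar{\boldsymbol x}\|_2\le R_\Omega$ for all $t\in T_y$.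
   Context: $\|\cdot\|_2$ is the Euclidean norm. $\Omega\subset\mathbb{R}^2$ is an open, bounded, convex set. *)

theory Defs
  imports "HOL-Analysis.Analysis"
begin

text \<open>
  With index type \<open>'n\<close> for the frequencies and N = \<open>CARD('n)\<close>, the stacked coefficient vector in
  4N-dimensional Euclidean space is an element of \<open>real ^ ('n \<times> 4)\<close>: the block belonging to frequency \<open>j\<close> is
  \<open>\<xi> $ (j, 1) = a\<^sub>j\<close>, \<open>\<xi> $ (j, 2) = b\<^sub>j\<close>, \<open>\<xi> $ (j, 3) = c\<^sub>j\<close>, \<open>\<xi> $ (j, 4) = d\<^sub>j\<close>.
  (In the type \<open>4\<close>, the numeral 4 equals 0, so 1, 2, 3, 4 are its four distinct elements.)
  The type-class norm on \<open>real ^ ('n \<times> 4)\<close> is the Euclidean norm over all 4N entries.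
\<close>

definition fourier_path ::
  "real ^ 2 \<Rightarrow> real ^ 'n \<Rightarrow> real ^ ('n::finite \<times> 4) \<Rightarrow> real \<Rightarrow> real ^ 2" where
  "fourier_path xbar \<omega> \<xi> t =
     xbar + (\<Sum>j\<in>UNIV. vector
       [\<xi> $ (j, 1) * cos (\<omega> $ j * t) + \<xi> $ (j, 2) * sin (\<omega> $ j * t),
        \<xi> $ (j, 3) * cos (\<omega> $ j * t) + \<xi> $ (j, 4) * sin (\<omega> $ j * t)])"

end

theory Submission
  imports Defs
begin

text \<open>
  At a fixed time, each harmonic is a vector in the plane whose two entries are inner products of
  \<open>(a\<^sub>j, b\<^sub>j)\<close> and \<open>(c\<^sub>j, d\<^sub>j)\<close> with the unit vector \<open>(cos (\<omega>\<^sub>j t), sin (\<omega>\<^sub>j t))\<close>. By Cauchy--Schwarz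
  its length is at most the Euclidean norm of its own coefficient block, whatever the frequency and
  the time (\<open>norm_harmonic_le\<close>). The triangle inequality then bounds the displacement from
  \<open>xbar\<close> by the \<open>\<ell>\<^sup>1\<close> norm of the \<open>N\<close> block norms. This is at most \<open>sqrt N\<close> times their \<open>\<ell>\<^sup>2\<close> norm
  (\<open>sum_le_sqrt_card_L2_set\<close>), and that \<open>\<ell>\<^sup>2\<close> norm is the norm of the whole coefficient vector
  (\<open>norm_vec_eq_L2_set_of_blocks\<close>). The factor \<open>sqrt N\<close> cancels the one in the hypothesis.
\<close>

text \<open>Cauchy--Schwarz against the unit vector \<open>(cos \<theta>, sin \<theta>)\<close>; the defect is the square of the
  component orthogonal to it.\<close>

lemma cos_sin_combination_square_le:
  fixes a b \<theta> :: real
  shows "(a * cos \<theta> + b * sin \<theta>)\<^sup>2 \<le> a\<^sup>2 + b\<^sup>2"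
proof -
  have "a\<^sup>2 + b\<^sup>2 = (a\<^sup>2 + b\<^sup>2) * ((cos \<theta>)\<^sup>2 + (sin \<theta>)\<^sup>2)"
    by simp
  also have "\<dots> = (a * cos \<theta> + b * sin \<theta>)\<^sup>2 + (a * sin \<theta> - b * cos \<theta>)\<^sup>2"
    by algebra
  finally show ?thesis
    by simp
qed

lemma norm_harmonic_le:
  fixes a b c d \<theta> :: real
  shows "norm (vector [a * cos \<theta> + b * sin \<theta>, c * cos \<theta> + d * sin \<theta>] :: real ^ 2)
    \<le> sqrt (a\<^sup>2 + b\<^sup>2 + c\<^sup>2 + d\<^sup>2)"
  using cos_sin_combination_square_le[of a \<theta> b] cos_sin_combination_square_le[of c \<theta> d]
  by (simp add: norm_vec_def L2_set_def sum_2)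

lemma norm_vec_eq_L2_set_of_blocks:
  fixes x :: "real ^ ('m::finite \<times> 'k::finite)"
  shows "norm x = L2_set (\<lambda>j. L2_set (\<lambda>k. x $ (j, k)) UNIV) UNIV"
  by (simp add: norm_vec_def L2_set_def sum_nonneg sum.cartesian_product)

text \<open>Cauchy--Schwarz against the constant function 1, whose \<open>\<ell>\<^sup>2\<close> norm is \<open>sqrt (card A)\<close>.\<close>

lemma sum_le_sqrt_card_L2_set:
  fixes f :: "'a \<Rightarrow> real"
  shows "sum f A \<le> sqrt (real (card A)) * L2_set f A"
proof -
  have "sum f A \<le> (\<Sum>i\<in>A. \<bar>1\<bar> * \<bar>f i\<bar>)"
    by (intro sum_mono) simp
  also have "\<dots> \<le> L2_set (\<lambda>_. 1) A * L2_set f A"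
    by (rule L2_set_mult_ineq)
  finally show ?thesis
    by (simp add: L2_set_def)
qed

theorem theorem6:
  fixes \<Omega> :: "(real ^ 2) set" and xbar :: "real ^ 2"
    and R :: real and T :: "real set"
    and \<omega> :: "real ^ 'n" and \<xi> :: "real ^ ('n::finite \<times> 4)"
  assumes "open \<Omega>" and "bounded \<Omega>" and "convex \<Omega>"
    and "xbar \<in> \<Omega>"
    and "R > 0"
    and "is_interval T" and "bounded T"
    and "norm \<xi> \<le> R / sqrt (real CARD('n))"
  shows "\<forall>t\<in>T. norm (fourier_path xbar \<omega> \<xi> t - xbar) \<le> R"
proof
  fix t
  let ?block = "\<lambda>j. L2_set (\<lambda>k. \<xi> $ (j, k)) UNIV"
  have "norm (fourier_path xbar \<omega> \<xi> t - xbar) \<le> (\<Sum>j\<in>UNIV. ?block j)"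
    unfolding fourier_path_def add_diff_cancel_left'
  proof (rule sum_norm_le)
    fix j
    have "?block j = sqrt ((\<xi> $ (j, 1))\<^sup>2 + (\<xi> $ (j, 2))\<^sup>2 + (\<xi> $ (j, 3))\<^sup>2 + (\<xi> $ (j, 4))\<^sup>2)"
      by (simp add: L2_set_def sum_4)
    then show "norm (vector
        [\<xi> $ (j, 1) * cos (\<omega> $ j * t) + \<xi> $ (j, 2) * sin (\<omega> $ j * t),
         \<xi> $ (j, 3) * cos (\<omega> $ j * t) + \<xi> $ (j, 4) * sin (\<omega> $ j * t)] :: real ^ 2) \<le> ?block j"
      by (simp only: norm_harmonic_le)
  qed
  also have "\<dots> \<le> sqrt (real CARD('n)) * norm \<xi>"
    unfolding norm_vec_eq_L2_set_of_blocks by (rule sum_le_sqrt_card_L2_set)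
  also have "\<dots> \<le> R"
    using assms(8) by (simp add: field_simps)
  finally show "norm (fourier_path xbar \<omega> \<xi> t - xbar) \<le> R" .
qed

end
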